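(* Let $n\geqslant 2$ and let $X\in\mathfrak{su}(n)$ be non-zero with eigenvalues $i\beta_1,i\beta_2,\ldots,i\beta_n$, where $\beta_1,\beta_2,\ldots,\beta_n$ are real numbers. The one-parameter subgroup $\phi_X:\mathbb{R}\to SU(n)$, $\phi_X(t)=e^{tX}$, is non-injective if and only if $\beta_1,\beta_2,\ldots,\beta_n$ are either all rational numbers or all rational multiples of the same irrational number.
   Context: $\mathfrak{su}(n)$ is the Lie algebra of $SU(n)$: traceless skew-Hermitian $n\times n$ complex matrices. *)

theory Defs
  imports Complex_Main "Jordan_Normal_Form.Schur_Decomposition"
    "Jordan_Normal_Form.Jordan_Normal_Form"
begin

definition mat_trace :: "'a :: comm_monoid_add mat \<Rightarrow> 'a" where
  "mat_trace A = (\<Sum>i<dim_row A. A $$ (i, i))"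

definition su_lie :: "nat \<Rightarrow> complex mat set" where
  "su_lie n = {X \<in> carrier_mat n n. mat_adjoint X = - X \<and> mat_trace X = 0}"

text \<open>The exponential series of a square matrix, summed entry by entry (matrices with carrier
  dimensions have no topology in the library). The series converges absolutely, see
  \<open>mat_exp_summable\<close> below, so that no default value of \<open>suminf\<close> is involved.\<close>

definition mat_exp :: "complex mat \<Rightarrow> complex mat" where
  "mat_exp A = mat (dim_row A) (dim_col A) (\<lambda>(i, j). \<Sum>k. (A ^\<^sub>m k) $$ (i, j) / fact k)"

definition one_param_subgroup :: "complex mat \<Rightarrow> real \<Rightarrow> complex mat" where
  "one_param_subgroup X t = mat_exp (complex_of_real t \<cdot>\<^sub>m X)"

lemma norm_bound_pow_mat:
  fixes A :: "complex mat"
  assumes A: "A \<in> carrier_mat n n" and b: "norm_bound A b"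
  shows "norm_bound (A ^\<^sub>m k) ((b * real n) ^ k)"
proof (induction k)
  case 0
  show ?case using A by (auto simp: norm_bound_def one_mat_def)
next
  case (Suc k)
  have "A ^\<^sub>m k \<in> carrier_mat n n" using A by simp
  from norm_bound_mult[OF this A Suc b] show ?case by (simp add: ac_simps)
qed

lemma mat_exp_summable:
  fixes A :: "complex mat"
  assumes A: "A \<in> carrier_mat n n" and ij: "i < n" "j < n"
  shows "summable (\<lambda>k. norm ((A ^\<^sub>m k) $$ (i, j) / fact k))"
proof -
  obtain b where b: "norm_bound A b" using norm_bound_max by blast
  show ?thesis
  proof (rule summable_comparison_test[OF exI[of _ 0], rule_format])
    fix k :: nat
    have "A ^\<^sub>m k \<in> carrier_mat n n" using A by simp
    then have "norm ((A ^\<^sub>m k) $$ (i, j)) \<le> (b * real n) ^ k"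
      using A norm_bound_pow_mat[OF A b, of k] ij by (auto simp: norm_bound_def)
    then show "norm (norm ((A ^\<^sub>m k) $$ (i, j) / fact k)) \<le> inverse (fact k) * (b * real n) ^ k"
      by (simp add: norm_divide divide_simps)
  qed (rule summable_exp)
qed

end

theory Submission
  imports Defs "Jordan_Normal_Form.Jordan_Normal_Form_Existence"
    "Jordan_Normal_Form.Jordan_Normal_Form_Uniqueness"
begin

text \<open>
  A skew-Hermitian matrix $X$ is diagonalizable, $X = P D P^{-1}$, and its eigenvalues are the
  numbers $i\beta_j$. Hence $e^{tX} = P e^{tD} P^{-1}$, and $e^{sX} = e^{tX}$ holds exactly if
  $e^{i(s-t)\beta_j} = 1$ for all $j$ (\<open>one_param_subgroup_eq_iff\<close>). So the one-parameter subgroup is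
  non-injective if and only if some $\tau \neq 0$ satisfies $\tau\beta_j \in 2\pi\mathbb{Z}$
  for all $j$. Such a $\tau$ makes every $\beta_j$ an integer multiple of $c = 2\pi/\tau$, where $c$
  may be rational or irrational; this is where the two alternatives come from. Conversely, if
  $\beta_j = q_j c$ with $c \neq 0$ and rational $q_j$, a common denominator $N$ of the $q_j$ gives
  the period $\tau = 2\pi N/c$ (\<open>common_period_iff_rationally_dependent\<close>).

  Diagonalizability matters because the periods are to be read off from the eigenvalues alone, and
  a Jordan block of size at least two for $a$ contributes an entry $t e^{ta}$, which vanishes only
  at $t = 0$. It is derived from the Jordan normal form. For a skew-Hermitian $N$ one has
  $\langle Nv, Nv\rangle = -\langle v, N^2v\rangle$, so $N^2$ and $N$ have the same kernel; applied
  to $N = X - a$ for every eigenvalue $a$, which is imaginary, this leaves no Jordan block of size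
  greater than one (\<open>skew_hermitian_diagonalizable\<close>).
\<close>

section \<open>Skew-Hermitian matrices are diagonalizable\<close>

lemma mat_adjoint_carrier:
  assumes "A \<in> carrier_mat n m"
  shows "mat_adjoint A \<in> carrier_mat m n"
  using assms by (intro carrier_matI) (auto simp: mat_adjoint_def)

lemma mat_adjoint_index:
  assumes "A \<in> carrier_mat n m" "i < m" "j < n"
  shows "mat_adjoint A $$ (i, j) = conjugate (A $$ (j, i))"
  using assms by (simp add: mat_adjoint_def mat_of_rows_def)

lemma cscalar_prod_mat_adjoint:
  fixes A :: "complex mat"
  assumes A: "A \<in> carrier_mat n m" and v: "v \<in> carrier_vec m" and w: "w \<in> carrier_vec n"
  shows "(A *\<^sub>v v) \<bullet>c w = v \<bullet>c (mat_adjoint A *\<^sub>v w)"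
proof -
  have adj: "mat_adjoint A \<in> carrier_mat m n"
    using A by (rule mat_adjoint_carrier)
  have "(A *\<^sub>v v) \<bullet>c w = (\<Sum>i<n. (\<Sum>k<m. A $$ (i, k) * v $ k) * cnj (w $ i))"
    using A v w by (simp add: scalar_prod_def lessThan_atLeast0)
  also have "\<dots> = (\<Sum>i<n. \<Sum>k<m. v $ k * (A $$ (i, k) * cnj (w $ i)))"
    by (simp add: sum_distrib_right mult.assoc mult.left_commute)
  also have "\<dots> = (\<Sum>k<m. \<Sum>i<n. v $ k * (A $$ (i, k) * cnj (w $ i)))"
    by (rule sum.swap)
  also have "\<dots> = (\<Sum>k<m. v $ k * cnj (\<Sum>i<n. mat_adjoint A $$ (k, i) * w $ i))"
    using A by (simp add: sum_distrib_left mat_adjoint_index)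
  also have "\<dots> = v \<bullet>c (mat_adjoint A *\<^sub>v w)"
    using adj v w by (simp add: scalar_prod_def lessThan_atLeast0)
  finally show ?thesis .
qed

lemma skew_hermitian_cscalar_prod:
  fixes A :: "complex mat"
  assumes A: "A \<in> carrier_mat n n" and skew: "mat_adjoint A = - A"
    and v: "v \<in> carrier_vec n" and w: "w \<in> carrier_vec n"
  shows "(A *\<^sub>v v) \<bullet>c w = - (v \<bullet>c (A *\<^sub>v w))"
proof -
  have neg: "- A *\<^sub>v w = - (A *\<^sub>v w)" using A w by auto
  have "(A *\<^sub>v v) \<bullet>c w = v \<bullet>c (- (A *\<^sub>v w))"
    using cscalar_prod_mat_adjoint[OF A v w] by (simp add: skew neg)
  also have "\<dots> = - (v \<bullet>c (A *\<^sub>v w))"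
    using A v w by (simp add: scalar_prod_def sum_negf)
  finally show ?thesis .
qed

text \<open>Evaluate $\langle Av, v\rangle = -\langle v, Av\rangle$ at an eigenvector and cancel
  $\langle v, v\rangle$.\<close>

lemma skew_hermitian_eigenvalue_imaginary:
  fixes A :: "complex mat"
  assumes A: "A \<in> carrier_mat n n" and skew: "mat_adjoint A = - A" and ev: "eigenvalue A a"
  shows "cnj a = - a"
proof -
  obtain v where "eigenvector A v a"
    using ev unfolding eigenvalue_def by blast
  then have v: "v \<in> carrier_vec n" "v \<noteq> 0\<^sub>v n" "A *\<^sub>v v = a \<cdot>\<^sub>v v"
    using A by (auto simp: eigenvector_def)
  have "a * (v \<bullet>c v) = - (cnj a * (v \<bullet>c v))"
    using skew_hermitian_cscalar_prod[OF A skew v(1) v(1)] v(1)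
    by (simp add: v(3) scalar_prod_def sum_distrib_left mult.assoc mult.left_commute)
  then have "(cnj a + a) * (v \<bullet>c v) = 0" by (simp add: algebra_simps)
  moreover have "v \<bullet>c v \<noteq> 0" using v(1,2) by simp
  ultimately show ?thesis by (simp add: eq_neg_iff_add_eq_0)
qed

text \<open>The shift by $a$ stays skew-Hermitian only because $a$ is imaginary; this is why the location of
  the eigenvalues has to be known before their generalized eigenspaces are examined.\<close>

lemma skew_hermitian_char_matrix:
  fixes A :: "complex mat"
  assumes A: "A \<in> carrier_mat n n" and skew: "mat_adjoint A = - A" and a: "cnj a = - a"
  shows "mat_adjoint (char_matrix A a) = - char_matrix A a"
proof (rule eq_matI)
  have C: "char_matrix A a \<in> carrier_mat n n" using A by simp
  show "dim_row (mat_adjoint (char_matrix A a)) = dim_row (- char_matrix A a)"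
    "dim_col (mat_adjoint (char_matrix A a)) = dim_col (- char_matrix A a)"
    using mat_adjoint_carrier[OF C] C by auto
  fix i j assume "i < dim_row (- char_matrix A a)" "j < dim_col (- char_matrix A a)"
  then have ij: "i < n" "j < n" using C by auto
  have "conjugate (A $$ (j, i)) = - A $$ (i, j)"
    using mat_adjoint_index[OF A ij] A ij skew by simp
  then show "mat_adjoint (char_matrix A a) $$ (i, j) = (- char_matrix A a) $$ (i, j)"
    using mat_adjoint_index[OF C ij] A C ij a by (auto simp: char_matrix_def)
qed

text \<open>If $A^2 v = 0$, then $\langle Av, Av\rangle = -\langle v, A^2 v\rangle = 0$, so $Av = 0$ because the
  inner product is definite.\<close>

lemma skew_hermitian_kernel_square:
  fixes A :: "complex mat"
  assumes A: "A \<in> carrier_mat n n" and skew: "mat_adjoint A = - A"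
  shows "mat_kernel (A ^\<^sub>m 2) = mat_kernel A"
proof -
  have pow: "A ^\<^sub>m 2 = A * A" using A by (simp add: numeral_2_eq_2)
  have assoc: "A * A *\<^sub>v v = A *\<^sub>v (A *\<^sub>v v)" if "v \<in> carrier_vec n" for v
    using A that by simp
  have "A *\<^sub>v v = 0\<^sub>v n" if v: "v \<in> carrier_vec n" and 0: "A *\<^sub>v (A *\<^sub>v v) = 0\<^sub>v n" for v
  proof -
    have Av: "A *\<^sub>v v \<in> carrier_vec n" using A v by simp
    have "(A *\<^sub>v v) \<bullet>c (A *\<^sub>v v) = 0"
      using skew_hermitian_cscalar_prod[OF A skew v Av] v by (simp add: 0 scalar_prod_def)
    then show ?thesis using Av by simp
  qed
  moreover have "A *\<^sub>v 0\<^sub>v n = 0\<^sub>v n" using A by auto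
  ultimately show ?thesis
    unfolding pow mat_kernel[OF A] mat_kernel[OF mult_carrier_mat[OF A A]]
    by (auto simp: assoc)
qed

text \<open>The kernel of $(A - a)^k$ has dimension $\sum \min(k, n)$, summed over the sizes $n$ of the
  Jordan blocks for $a$. If this does not grow from $k = 1$ to $k = 2$, no block is larger than $1$.\<close>

lemma min_sum_list_eq_imp_le_1:
  fixes ns :: "nat list"
  assumes "(\<Sum>n\<leftarrow>ns. min 2 n) = (\<Sum>n\<leftarrow>ns. min 1 n)" "n \<in> set ns"
  shows "n \<le> 1"
  using assms
proof (induction ns)
  case (Cons m ns)
  have "(\<Sum>n\<leftarrow>ns. min 1 n) \<le> (\<Sum>n\<leftarrow>ns. min 2 n)"
    by (rule sum_list_mono) auto
  moreover have "min 2 m + (\<Sum>n\<leftarrow>ns. min 2 n) = min 1 m + (\<Sum>n\<leftarrow>ns. min 1 n)"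
    using Cons.prems by simp
  ultimately have "(\<Sum>n\<leftarrow>ns. min 2 n) = (\<Sum>n\<leftarrow>ns. min 1 n)" "m \<le> 1"
    by linarith+
  with Cons show ?case by auto
qed simp

theorem skew_hermitian_diagonalizable:
  fixes A :: "complex mat"
  assumes A: "A \<in> carrier_mat n n" and skew: "mat_adjoint A = - A"
  obtains D P Q where "similar_mat_wit A D P Q" "diagonal_mat D"
proof -
  obtain n_as where jnf: "jordan_nf A n_as"
    using char_poly_factorized[OF A] jordan_nf_exists[OF A] by blast
  then have sim: "similar_mat A (jordan_matrix n_as)" and pos: "0 \<notin> fst ` set n_as"
    by (auto simp: jordan_nf_def)
  have one: "k = 1" if ka: "(k, a) \<in> set n_as" for k a
  proof -
    have "k \<noteq> 0" using pos ka by force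
    moreover have "char_poly A = (\<Prod>(k, a)\<leftarrow>n_as. [:- a, 1:] ^ k)"
      using char_poly_similar[OF sim] by (simp add: jordan_matrix_char_poly)
    ultimately have "poly (char_poly A) a = 0"
      using ka by (auto simp: poly_prod_list o_def intro!: rev_image_eqI[of "(k, a)"])
    then have "cnj a = - a"
      using skew_hermitian_eigenvalue_imaginary[OF A skew] eigenvalue_root_char_poly[OF A] by simp
    then have "mat_kernel (char_matrix A a ^\<^sub>m 2) = mat_kernel (char_matrix A a)"
      using A skew_hermitian_kernel_square[of "char_matrix A a" n]
        skew_hermitian_char_matrix[OF A skew] by simp
    then have "dim_gen_eigenspace A a 2 = dim_gen_eigenspace A a 1"
      using A by (simp add: dim_gen_eigenspace_def kernel_dim_def)
    then show "k = 1"
      using min_sum_list_eq_imp_le_1[of "map fst [(k, e)\<leftarrow>n_as . e = a]" k] ka \<open>k \<noteq> 0\<close>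
      unfolding dim_gen_eigenspace[OF jnf] by force
  qed
  \<comment> \<open>A block-diagonal matrix with blocks of size one is diagonal.\<close>
  have "jordan_matrix n_as = mk_diagonal (map snd n_as)"
    unfolding jordan_matrix_def mk_diagonal_def
    by (rule arg_cong[of _ _ diag_block_mat])
      (auto simp: jordan_block_def dest!: one)
  with sim mk_diagonal_diagonal show thesis
    using that unfolding similar_mat_def by metis
qed

section \<open>The exponential of a diagonalizable matrix\<close>

lemma pow_diagonal_mat:
  fixes D :: "'a :: comm_semiring_1 mat"
  assumes D: "D \<in> carrier_mat n n" and diag: "diagonal_mat D"
  shows "D ^\<^sub>m k = mat n n (\<lambda>(i, j). if i = j then (D $$ (i, i)) ^ k else 0)"
proof (induction k)
  case 0
  show ?case using D by (auto intro!: eq_matI)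
next
  case (Suc k)
  show ?case unfolding pow_mat.simps Suc
  proof (rule eq_matI)
    fix i j
    assume "i < dim_row (mat n n (\<lambda>(i, j). if i = j then (D $$ (i, i)) ^ Suc k else 0))"
      "j < dim_col (mat n n (\<lambda>(i, j). if i = j then (D $$ (i, i)) ^ Suc k else 0))"
    then have ij: "i < n" "j < n" by auto
    have "(mat n n (\<lambda>(i, j). if i = j then (D $$ (i, i)) ^ k else 0) * D) $$ (i, j) =
      (\<Sum>l = 0..<n. (if i = l then (D $$ (i, i)) ^ k else 0) * D $$ (l, j))"
      using D ij by (simp add: scalar_prod_def)
    also have "\<dots> = (D $$ (i, i)) ^ k * D $$ (i, j)"
      using ij by (subst sum.remove[of _ i]) auto
    also have "\<dots> = (if i = j then (D $$ (i, i)) ^ Suc k else 0)"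
      using diag D ij by (auto simp: diagonal_mat_def mult.commute)
    finally show "(mat n n (\<lambda>(i, j). if i = j then (D $$ (i, i)) ^ k else 0) * D) $$ (i, j) =
      mat n n (\<lambda>(i, j). if i = j then (D $$ (i, i)) ^ Suc k else 0) $$ (i, j)"
      using ij by simp
  qed (use D in auto)
qed

lemma conj_diagonal_index:
  fixes P Q :: "'a :: comm_semiring_1 mat"
  assumes P: "P \<in> carrier_mat n n" and Q: "Q \<in> carrier_mat n n" and ij: "i < n" "j < n"
  shows "(P * mat n n (\<lambda>(k, l). if k = l then d k else 0) * Q) $$ (i, j) =
    (\<Sum>l<n. P $$ (i, l) * d l * Q $$ (l, j))"
proof -
  have "(P * mat n n (\<lambda>(k, l). if k = l then d k else 0)) $$ (i, l) = P $$ (i, l) * d l"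
    if "l < n" for l
    using P ij that by (simp add: scalar_prod_def if_distrib[of "\<lambda>x. _ * x"] cong: if_cong)
  then show ?thesis
    using P Q ij by (simp add: scalar_prod_def lessThan_atLeast0)
qed

text \<open>Each entry of $A^k = P D^k Q$ is a fixed linear combination of the $k$-th powers of the diagonal
  entries of $D$, so the entrywise exponential series is a finite combination of scalar ones.\<close>

lemma mat_exp_diagonalizable:
  assumes A: "A \<in> carrier_mat n n" and sim: "similar_mat_wit A D P Q" and diag: "diagonal_mat D"
  shows "mat_exp A = P * mat n n (\<lambda>(i, j). if i = j then exp (D $$ (i, i)) else 0) * Q"
proof (rule eq_matI)
  note wit = similar_mat_witD2[OF A sim]
  let ?E = "mat n n (\<lambda>(i, j). if i = j then exp (D $$ (i, i)) else 0)"
  show "dim_row (mat_exp A) = dim_row (P * ?E * Q)" "dim_col (mat_exp A) = dim_col (P * ?E * Q)"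
    using A wit by (auto simp: mat_exp_def)
  fix i j assume "i < dim_row (P * ?E * Q)" "j < dim_col (P * ?E * Q)"
  then have ij: "i < n" "j < n" using wit by auto
  have "(A ^\<^sub>m k) $$ (i, j) / fact k =
    (\<Sum>l<n. P $$ (i, l) * ((D $$ (l, l)) ^ k /\<^sub>R fact k) * Q $$ (l, j))" for k
    unfolding similar_mat_wit_pow_id[OF sim] pow_diagonal_mat[OF wit(5) diag]
      conj_diagonal_index[OF wit(6,7) ij]
    by (simp add: sum_divide_distrib scaleR_conv_of_real divide_simps)
  moreover have "(\<lambda>k. \<Sum>l<n. P $$ (i, l) * ((D $$ (l, l)) ^ k /\<^sub>R fact k) * Q $$ (l, j)) sums
    (\<Sum>l<n. P $$ (i, l) * exp (D $$ (l, l)) * Q $$ (l, j))"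
    by (intro sums_sum sums_mult sums_mult2 exp_converges)
  ultimately have "(\<lambda>k. (A ^\<^sub>m k) $$ (i, j) / fact k) sums (P * ?E * Q) $$ (i, j)"
    unfolding conj_diagonal_index[OF wit(6,7) ij] by simp
  then show "mat_exp A $$ (i, j) = (P * ?E * Q) $$ (i, j)"
    using A ij by (simp add: mat_exp_def sums_iff)
qed

text \<open>Conjugation by $P$ is injective, so equality of two exponentials can be tested on the diagonal.\<close>

lemma one_param_subgroup_eq_iff:
  assumes A: "A \<in> carrier_mat n n" and sim: "similar_mat_wit A D P Q" and diag: "diagonal_mat D"
  shows "one_param_subgroup A s = one_param_subgroup A t \<longleftrightarrow>
    (\<forall>a \<in> set (diag_mat D). exp (s * a) = exp (t * a))"
proof -
  note wit = similar_mat_witD2[OF A sim]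
  define E where "E r = mat n n (\<lambda>(i, j). if i = j then exp (complex_of_real r * D $$ (i, i)) else 0)"
    for r
  have E: "E r \<in> carrier_mat n n" for r by (simp add: E_def)
  have phi: "one_param_subgroup A r = P * E r * Q" for r
  proof -
    have "diagonal_mat (complex_of_real r \<cdot>\<^sub>m D)"
      using diag by (auto simp: diagonal_mat_def)
    from mat_exp_diagonalizable[OF _ similar_mat_wit_smult[OF sim] this, of n]
    have "one_param_subgroup A r =
      P * mat n n (\<lambda>(i, j). if i = j then exp ((complex_of_real r \<cdot>\<^sub>m D) $$ (i, i)) else 0) * Q"
      using A by (simp add: one_param_subgroup_def)
    also have "mat n n (\<lambda>(i, j). if i = j then exp ((complex_of_real r \<cdot>\<^sub>m D) $$ (i, i)) else 0) = E r"
      using wit(5) by (auto simp: E_def intro!: eq_matI)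
    finally show ?thesis .
  qed
  have "Q * (P * E r * Q) * P = E r" for r
  proof -
    have "Q * (P * E r * Q) * P = (Q * P) * E r * (Q * P)"
      using wit(6,7) E[of r] by (simp add: assoc_mult_mat[of _ n n _ n _ n])
    then show ?thesis using wit(2) E[of r] by simp
  qed
  then have "one_param_subgroup A s = one_param_subgroup A t \<longleftrightarrow> E s = E t"
    unfolding phi by metis
  also have "\<dots> \<longleftrightarrow> (\<forall>i<n. exp (s * D $$ (i, i)) = exp (t * D $$ (i, i)))"
  proof
    assume "E s = E t"
    show "\<forall>i<n. exp (s * D $$ (i, i)) = exp (t * D $$ (i, i))"
    proof (intro allI impI)
      fix i assume "i < n"
      with arg_cong[OF \<open>E s = E t\<close>, of "\<lambda>M. M $$ (i, i)"]
      show "exp (s * D $$ (i, i)) = exp (t * D $$ (i, i))" by (simp add: E_def)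
    qed
  qed (auto simp: E_def intro!: eq_matI)
  also have "\<dots> \<longleftrightarrow> (\<forall>a \<in> set (diag_mat D). exp (s * a) = exp (t * a))"
    using wit(5) by (auto simp: diag_mat_def)
  finally show ?thesis .
qed

text \<open>Similar matrices share their characteristic polynomial, and that of a diagonal matrix splits
  into the linear factors of its diagonal entries.\<close>

lemma set_diag_mat_similar_diagonal:
  fixes A :: "'a :: field mat"
  assumes A: "A \<in> carrier_mat n n" and sim: "similar_mat_wit A D P Q" and diag: "diagonal_mat D"
  shows "set (diag_mat D) = {a. poly (char_poly A) a = 0}"
proof -
  note wit = similar_mat_witD2[OF A sim]
  have "upper_triangular D"
    using diag wit(5) by (auto simp: diagonal_mat_def upper_triangular_def)
  then have "char_poly A = (\<Prod>a\<leftarrow>diag_mat D. [:- a, 1:])"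
    using char_poly_upper_triangular[OF wit(5)] char_poly_similar[of A D] sim
    by (auto simp: similar_mat_def)
  then show ?thesis by (auto simp: poly_prod_list o_def)
qed

section \<open>Common periods and rational dependence\<close>

lemma exp_imaginary_eq_1_iff:
  "exp (\<i> * complex_of_real x) = 1 \<longleftrightarrow> (\<exists>k::int. x = 2 * pi * k)"
proof -
  have "exp (\<i> * complex_of_real x) = 1 \<longleftrightarrow> cos x = 1 \<and> sin x = 0"
    by (simp add: cis_conv_exp[symmetric] complex_eq_iff)
  also have "\<dots> \<longleftrightarrow> cos x = 1"
    using cos_one_sin_zero[of x] by auto
  also have "\<dots> \<longleftrightarrow> (\<exists>k::int. x = 2 * pi * k)"
    by (auto simp: cos_one_2pi_int ac_simps)
  finally show ?thesis .
qed

lemma rational_common_denominator: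
  fixes q :: "'a \<Rightarrow> real"
  assumes "finite J" "\<And>j. j \<in> J \<Longrightarrow> q j \<in> \<rat>"
  shows "\<exists>N. (0::int) < N \<and> (\<forall>j\<in>J. N * q j \<in> \<int>)"
  using assms
proof (induction J)
  case empty
  show ?case by (auto intro: exI[of _ 1])
next
  case (insert x J)
  then obtain N :: int where N: "(0::int) < N" "\<forall>j\<in>J. N * q j \<in> \<int>" by auto
  obtain a b :: int where ab: "(0::int) < b" "q x = a / b"
    using insert.prems[of x] by (auto elim: Rats_cases')
  have "(N * b) * q j \<in> \<int>" if j: "j \<in> insert x J" for j
  proof (cases "j = x")
    case True
    then have "(N * b) * q j = of_int (N * a)" using ab by simp
    then show ?thesis by (metis Ints_of_int)
  next
    case False
    then have "of_int b * (N * q j) \<in> \<int>" using N(2) j by (intro Ints_mult[of "of_int b"]) auto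
    then show ?thesis by (simp add: ac_simps)
  qed
  then show ?case using N ab by (intro exI[of _ "N * b"]) auto
qed

text \<open>A common period $\tau$ says that all $\beta_j$ are integer multiples of $c = 2\pi/\tau$, and
  clearing denominators shows that rational multiples of some $c \neq 0$ suffice. The right-hand side
  splits this condition according to whether $c$ can be taken rational (then $c = 1$ serves) or not.\<close>

lemma common_period_iff_rationally_dependent:
  fixes \<beta> :: "'a \<Rightarrow> real"
  assumes fin: "finite J"
  shows "(\<exists>\<tau>. \<tau> \<noteq> 0 \<and> (\<forall>j\<in>J. \<exists>k::int. \<tau> * \<beta> j = 2 * pi * k)) \<longleftrightarrow>
    (\<forall>j\<in>J. \<beta> j \<in> \<rat>) \<or> (\<exists>c. c \<notin> \<rat> \<and> (\<forall>j\<in>J. \<exists>q\<in>\<rat>. \<beta> j = q * c))"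
proof
  assume "\<exists>\<tau>. \<tau> \<noteq> 0 \<and> (\<forall>j\<in>J. \<exists>k::int. \<tau> * \<beta> j = 2 * pi * k)"
  then obtain \<tau> where \<tau>: "\<tau> \<noteq> 0" "\<forall>j\<in>J. \<exists>k::int. \<tau> * \<beta> j = 2 * pi * k" by blast
  define c where "c = 2 * pi / \<tau>"
  have \<beta>: "\<exists>q\<in>\<rat>. \<beta> j = q * c" if j: "j \<in> J" for j
  proof -
    obtain k :: int where "\<tau> * \<beta> j = 2 * pi * k" using \<tau>(2) j by blast
    then have "\<beta> j = k * c" using \<tau>(1) by (simp add: c_def field_simps)
    then show ?thesis by (intro bexI[of _ "of_int k"]) auto
  qed
  show "(\<forall>j\<in>J. \<beta> j \<in> \<rat>) \<or> (\<exists>c. c \<notin> \<rat> \<and> (\<forall>j\<in>J. \<exists>q\<in>\<rat>. \<beta> j = q * c))"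
  proof (cases "c \<in> \<rat>")
    case True
    have "\<beta> j \<in> \<rat>" if "j \<in> J" for j
      using \<beta>[OF that] True by auto
    then show ?thesis by blast
  next
    case False
    then show ?thesis using \<beta> by blast
  qed
next
  assume "(\<forall>j\<in>J. \<beta> j \<in> \<rat>) \<or> (\<exists>c. c \<notin> \<rat> \<and> (\<forall>j\<in>J. \<exists>q\<in>\<rat>. \<beta> j = q * c))"
  then have "\<exists>c. c \<noteq> 0 \<and> (\<forall>j\<in>J. \<exists>q\<in>\<rat>. \<beta> j = q * c)"
  proof
    assume "\<forall>j\<in>J. \<beta> j \<in> \<rat>"
    then show ?thesis by (intro exI[of _ 1]) auto
  next
    assume "\<exists>c. c \<notin> \<rat> \<and> (\<forall>j\<in>J. \<exists>q\<in>\<rat>. \<beta> j = q * c)"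
    then obtain c where c: "c \<notin> \<rat>" "\<forall>j\<in>J. \<exists>q\<in>\<rat>. \<beta> j = q * c" by blast
    from c(1) have "c \<noteq> 0" by auto
    with c(2) show ?thesis by blast
  qed
  then obtain c where c: "c \<noteq> 0" "\<forall>j\<in>J. \<exists>q. q \<in> \<rat> \<and> \<beta> j = q * c" by blast
  from bchoice[OF c(2)] obtain q
    where q: "\<And>j. j \<in> J \<Longrightarrow> q j \<in> \<rat>" "\<And>j. j \<in> J \<Longrightarrow> \<beta> j = q j * c" by blast
  obtain N where N: "(0::int) < N" "\<forall>j\<in>J. N * q j \<in> \<int>"
    using rational_common_denominator[of J q, OF fin q(1)] by blast
  have "\<exists>k::int. (2 * pi * N / c) * \<beta> j = 2 * pi * k" if j: "j \<in> J" for j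
  proof -
    obtain k :: int where "N * q j = k" using N(2) j by (auto elim: Ints_cases)
    then have "(2 * pi * N / c) * \<beta> j = 2 * pi * k" using c(1) by (simp add: q(2)[OF j])
    then show ?thesis ..
  qed
  then show "\<exists>\<tau>. \<tau> \<noteq> 0 \<and> (\<forall>j\<in>J. \<exists>k::int. \<tau> * \<beta> j = 2 * pi * k)"
    using c(1) N(1) by (intro exI[of _ "2 * pi * N / c"]) auto
qed

section \<open>Non-injective one-parameter subgroups\<close>

theorem corollary7:
  fixes n :: nat and X :: "complex mat" and \<beta> :: "nat \<Rightarrow> real"
  assumes "n \<ge> 2"
    and "X \<in> su_lie n"
    and "X \<noteq> 0\<^sub>m n n"
    and "char_poly X = (\<Prod>j=1..n. [:- (\<i> * complex_of_real (\<beta> j)), 1:])"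
  shows "\<not> inj (one_param_subgroup X) \<longleftrightarrow>
    (\<forall>j\<in>{1..n}. \<beta> j \<in> \<rat>) \<or>
    (\<exists>c. c \<notin> \<rat> \<and> (\<forall>j\<in>{1..n}. \<exists>q\<in>\<rat>. \<beta> j = q * c))"
proof -
  have X: "X \<in> carrier_mat n n" and skew: "mat_adjoint X = - X"
    using assms(2) by (auto simp: su_lie_def)
  obtain D P Q where sim: "similar_mat_wit X D P Q" and diag: "diagonal_mat D"
    using skew_hermitian_diagonalizable[OF X skew] .
  have spec: "set (diag_mat D) = (\<lambda>j. \<i> * complex_of_real (\<beta> j)) ` {1..n}"
    unfolding set_diag_mat_similar_diagonal[OF X sim diag] assms(4)
    by (auto simp: poly_prod)
  have eq_iff: "one_param_subgroup X s = one_param_subgroup X t \<longleftrightarrow>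
    (\<forall>j\<in>{1..n}. \<exists>k::int. (s - t) * \<beta> j = 2 * pi * k)" for s t
  proof -
    have "exp (s * (\<i> * \<beta> j)) = exp (t * (\<i> * \<beta> j)) \<longleftrightarrow>
      (\<exists>k::int. (s - t) * \<beta> j = 2 * pi * k)" for j
    proof -
      have "\<i> * complex_of_real ((s - t) * \<beta> j) = s * (\<i> * \<beta> j) - t * (\<i> * \<beta> j)"
        by (simp add: algebra_simps)
      then have "exp (s * (\<i> * \<beta> j)) = exp (t * (\<i> * \<beta> j)) \<longleftrightarrow>
        exp (\<i> * complex_of_real ((s - t) * \<beta> j)) = 1"
        by (simp add: exp_diff)
      then show ?thesis unfolding exp_imaginary_eq_1_iff .
    qed
    then show ?thesis
      unfolding one_param_subgroup_eq_iff[OF X sim diag] spec by simp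
  qed
  have "\<not> inj (one_param_subgroup X) \<longleftrightarrow>
    (\<exists>s t. s - t \<noteq> 0 \<and> (\<forall>j\<in>{1..n}. \<exists>k::int. (s - t) * \<beta> j = 2 * pi * k))"
    by (auto simp: inj_def eq_iff)
  also have "\<dots> \<longleftrightarrow> (\<exists>\<tau>. \<tau> \<noteq> 0 \<and> (\<forall>j\<in>{1..n}. \<exists>k::int. \<tau> * \<beta> j = 2 * pi * k))"
    by (metis diff_zero)
  also have "\<dots> \<longleftrightarrow> (\<forall>j\<in>{1..n}. \<beta> j \<in> \<rat>) \<or>
    (\<exists>c. c \<notin> \<rat> \<and> (\<forall>j\<in>{1..n}. \<exists>q\<in>\<rat>. \<beta> j = q * c))"
    by (rule common_period_iff_rationally_dependent) simp
  finally show ?thesis .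
qed

end
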